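(* Let $(C,\bar\xi)$ be a versor field in a Myller configuration with alternative frame $R_A=\{P(s);\bar\xi_2,\bar Y,\bar D\}$ and (nowhere) non-zero alternative curvatures $p,q$. Then $\bar D$ satisfies the differential equation $$\bar D'''-\left[\frac{(pq)'}{pq}+\frac{q'}{q}\right]\bar D''+\left\{pq\left[\frac1p\left(\frac1q\right)'\right]'+p^2+q^2\right\}\bar D'+pq\left(\frac qp\right)'\bar D=0.$$
   Context: All data are smooth. Let $C$ be a curve in Euclidean space $E^3$ with arclength parameter $s\in I$ ($I$ an interval) and position vector $\bar r(s)$, let $\bar\xi(s)$ be a unit vector field along $C$ (a versor field $(C,\bar\xi)$), and let $\pi(s)$ be a plane field along $C$ with $\bar\xi(s)\in\pi(s)$. The pair $((C,\bar\xi),(C,\pi))$ is called a Myller configuration $M=M(C,\bar\xi,\pi)$. Put $\bar\xi_1=\bar\xi$, $K_1=\|d\bar\xi/ds\|>0$ (curvature), define $\bar\xi_2$ by $\bar\xi_1'=K_1\bar\xi_2$, and $\bar\xi_3=\bar\xi_1\times\bar\xi_2$. Then $\{\bar\xi_1,\bar\xi_2,\bar\xi_3\}$ is a positively oriented orthonormal frame, the Frenet-type frame $R_F$, and $$\bar\xi_1'=K_1\bar\xi_2,\quad \bar\xi_2'=-K_1\bar\xi_1+K_2\bar\xi_3,\quad \bar\xi_3'=-K_2\bar\xi_2,$$ which defines the torsion $K_2$. A prime denotes $d/ds$. The alternative frame (AF-frame) is the orthonormal frame $R_A=\{P(s);\bar\xi_2,\bar Y,\bar D\}$ with $\bar Y=\bar\xi_2'/\|\bar\xi_2'\|$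 and $\bar D=\bar\xi_2\times\bar Y=\frac{K_2}{\sqrt{K_1^2+K_2^2}}\bar\xi_1+\frac{K_1}{\sqrt{K_1^2+K_2^2}}\bar\xi_3$. It satisfies $\bar\xi_2'=p\bar Y$, $\bar Y'=-p\bar\xi_2+q\bar D$, $\bar D'=-q\bar Y$, where the alternative curvatures are $p=\sqrt{K_1^2+K_2^2}$ and $q=\frac{K_1^2}{K_1^2+K_2^2}\left(\frac{K_2}{K_1}\right)'$. *)

theory Defs
  imports "HOL-Analysis.Analysis"
begin

text \<open>
  The parameter interval may be open, closed or half-open: derivatives are taken within it, so they
  are one-sided at an end point that belongs to the interval and ordinary in the interior.
  The same operator serves for vector-valued and for real-valued functions.
\<close>

definition param_interval :: "real set \<Rightarrow> bool" where
  "param_interval I \<longleftrightarrow> is_interval I \<and> (\<exists>a\<in>I. \<exists>b\<in>I. a < b)"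

definition dds :: "real set \<Rightarrow> (real \<Rightarrow> 'a::real_normed_vector) \<Rightarrow> real \<Rightarrow> 'a" where
  "dds I f s = vector_derivative f (at s within I)"

definition smooth_on :: "real set \<Rightarrow> (real \<Rightarrow> 'a::real_normed_vector) \<Rightarrow> bool" where
  "smooth_on I f \<longleftrightarrow> (\<forall>n. \<forall>s\<in>I. ((dds I ^^ n) f) differentiable (at s within I))"

definition arclength_curve :: "real set \<Rightarrow> (real \<Rightarrow> real^3) \<Rightarrow> bool" where
  "arclength_curve I r \<longleftrightarrow> smooth_on I r \<and> (\<forall>s\<in>I. norm (dds I r s) = 1)"

definition unit_field :: "real set \<Rightarrow> (real \<Rightarrow> real^3) \<Rightarrow> bool" where
  "unit_field I \<xi> \<longleftrightarrow> smooth_on I \<xi> \<and> (\<forall>s\<in>I. norm (\<xi> s) = 1)"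

text \<open>
  A plane of the field is represented by its direction plane, a two-dimensional linear subspace.
  Smoothness is that of a unit normal field; over an interval a smooth plane field always has a
  global one.
\<close>

definition plane_field :: "real set \<Rightarrow> (real \<Rightarrow> (real^3) set) \<Rightarrow> bool" where
  "plane_field I \<pi> \<longleftrightarrow> (\<exists>\<nu>. unit_field I \<nu> \<and> (\<forall>s\<in>I. \<pi> s = {v. \<nu> s \<bullet> v = 0}))"

definition myller_configuration ::
    "real set \<Rightarrow> (real \<Rightarrow> real^3) \<Rightarrow> (real \<Rightarrow> real^3) \<Rightarrow> (real \<Rightarrow> (real^3) set) \<Rightarrow> bool" where
  "myller_configuration I r \<xi> \<pi> \<longleftrightarrow>
     param_interval I \<and> arclength_curve I r \<and> unit_field I \<xi> \<and> plane_field I \<pi> \<and>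
     (\<forall>s\<in>I. \<xi> s \<in> \<pi> s)"

definition K1 :: "real set \<Rightarrow> (real \<Rightarrow> real^3) \<Rightarrow> real \<Rightarrow> real" where
  "K1 I \<xi> s = norm (dds I \<xi> s)"

definition xi2 :: "real set \<Rightarrow> (real \<Rightarrow> real^3) \<Rightarrow> real \<Rightarrow> real^3" where
  "xi2 I \<xi> s = (1 / K1 I \<xi> s) *\<^sub>R dds I \<xi> s"

definition xi3 :: "real set \<Rightarrow> (real \<Rightarrow> real^3) \<Rightarrow> real \<Rightarrow> real^3" where
  "xi3 I \<xi> s = cross3 (\<xi> s) (xi2 I \<xi> s)"

text \<open>
  The torsion is the coefficient determined by the second Frenet-type equation; it exists and is
  unique at every point where the curvature is positive.
\<close>

definition K2 :: "real set \<Rightarrow> (real \<Rightarrow> real^3) \<Rightarrow> real \<Rightarrow> real" where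
  "K2 I \<xi> s = (THE k. dds I (xi2 I \<xi>) s = - (K1 I \<xi> s *\<^sub>R \<xi> s) + k *\<^sub>R xi3 I \<xi> s)"

definition alt_Y :: "real set \<Rightarrow> (real \<Rightarrow> real^3) \<Rightarrow> real \<Rightarrow> real^3" where
  "alt_Y I \<xi> s = (1 / norm (dds I (xi2 I \<xi>) s)) *\<^sub>R dds I (xi2 I \<xi>) s"

definition alt_D :: "real set \<Rightarrow> (real \<Rightarrow> real^3) \<Rightarrow> real \<Rightarrow> real^3" where
  "alt_D I \<xi> s = cross3 (xi2 I \<xi> s) (alt_Y I \<xi> s)"

definition alt_p :: "real set \<Rightarrow> (real \<Rightarrow> real^3) \<Rightarrow> real \<Rightarrow> real" where
  "alt_p I \<xi> s = sqrt ((K1 I \<xi> s)\<^sup>2 + (K2 I \<xi> s)\<^sup>2)"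

definition alt_q :: "real set \<Rightarrow> (real \<Rightarrow> real^3) \<Rightarrow> real \<Rightarrow> real" where
  "alt_q I \<xi> s =
     (K1 I \<xi> s)\<^sup>2 / ((K1 I \<xi> s)\<^sup>2 + (K2 I \<xi> s)\<^sup>2) * dds I (\<lambda>t. K2 I \<xi> t / K1 I \<xi> t) s"

end

theory Submission imports Defs begin

text \<open>
  In the alternative frame the moving frame formulas are \<open>\<xi>\<^sub>2' = p Y\<close>, \<open>Y' = - p \<xi>\<^sub>2 + q D\<close> and
  \<open>D' = - q Y\<close>. Differentiating the last one twice gives
  \<open>D'' = p q \<xi>\<^sub>2 - q' Y - q\<^sup>2 D\<close> and
  \<open>D''' = ((p q)' + p q') \<xi>\<^sub>2 + (p\<^sup>2 q + q\<^sup>3 - q'') Y - 3 q q' D\<close>.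
  As \<open>p q\<close> and \<open>q\<close> do not vanish, subtracting a multiple of \<open>D''\<close> removes \<open>\<xi>\<^sub>2\<close> from \<open>D'''\<close>, and
  adding a multiple of \<open>D'\<close> then removes \<open>Y\<close>; what remains is a multiple of \<open>D\<close>. Moving it to the
  other side gives the equation, with these multiples as coefficients (\<open>third_frame_vector_ode\<close>).

  The frame formulas themselves come from two sources. The Frenet-type formulas (\<open>frenet_frame\<close>)
  follow from orthonormality alone. They make \<open>(Y, D)\<close> an orthonormal basis of the plane spanned by
  \<open>\<xi>\<close> and \<open>\<xi>\<^sub>3\<close>, namely \<open>Y = - b \<xi> + a \<xi>\<^sub>3\<close> and \<open>D = a \<xi> + b \<xi>\<^sub>3\<close> with \<open>a = K\<^sub>2/p\<close> and
  \<open>b = K\<^sub>1/p\<close>, and \<open>q\<close> is the angular velocity of the point \<open>(a, b)\<close> of the unit circle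
  (\<open>unit_circle_derivative\<close>, \<open>alternative_frame\<close>).

  The equation involves second derivatives of \<open>q\<close>, which is itself built from derivatives of
  \<open>\<xi>\<close>, norms and quotients; smoothness of \<open>p\<close> and \<open>q\<close> rests on the stability of smooth functions
  under bilinear operations, quotients and square roots of positive functions.
\<close>

section \<open>Derivatives within a parameter interval\<close>

text \<open>
  Every point of a nondegenerate interval, an end point included, is a limit point of it. This is
  what makes derivatives within the interval unique.
\<close>

lemma at_within_param_interval_nontrivial:
  assumes "param_interval I" "s \<in> I"
  shows "at s within I \<noteq> bot"
proof -
  have "connected I"
    using assms(1) by (simp add: param_interval_def is_interval_connected)
  moreover have "\<nexists>x. I = {x}"
    using assms(1) by (force simp: param_interval_def)
  ultimately have "s islimpt I"
    using assms(2) by (blast intro: connected_imp_perfect)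
  then show ?thesis
    using trivial_limit_within by blast
qed

lemma dds_eqI:
  assumes "param_interval I" "s \<in> I" "(f has_vector_derivative f') (at s within I)"
  shows "dds I f s = f'"
  unfolding dds_def
  by (rule vector_derivative_within[OF at_within_param_interval_nontrivial[OF assms(1,2)] assms(3)])

lemma has_vector_derivative_dds:
  "f differentiable (at s within I) \<Longrightarrow> (f has_vector_derivative dds I f s) (at s within I)"
  unfolding dds_def using vector_derivative_works by blast

lemma has_vector_derivative_within_cong:
  assumes "\<And>t. t \<in> I \<Longrightarrow> f t = g t" "s \<in> I"
  shows "(f has_vector_derivative f') (at s within I) \<longleftrightarrow>
         (g has_vector_derivative f') (at s within I)"
proof -
  have "(h has_vector_derivative f') (at s within I)"
    if "\<And>t. t \<in> I \<Longrightarrow> k t = h t" "(k has_vector_derivative f') (at s within I)"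
    for h k :: "real \<Rightarrow> 'a"
    by (rule has_vector_derivative_transform[OF assms(2) _ that(2)]) (simp add: that(1))
  from this[of f g] this[of g f] show ?thesis
    using assms(1) by auto
qed

lemma dds_cong:
  assumes "\<And>t. t \<in> I \<Longrightarrow> f t = g t" "s \<in> I"
  shows "dds I f s = dds I g s"
  unfolding dds_def vector_derivative_def
  by (simp add: has_vector_derivative_within_cong[OF assms])

lemma dds_eq_of_derivative:
  assumes "param_interval I" "s \<in> I" "\<And>t. t \<in> I \<Longrightarrow> (f has_vector_derivative f' t) (at t within I)"
    "(f' has_vector_derivative f'') (at s within I)"
  shows "dds I (dds I f) s = f''"
proof -
  have "dds I (dds I f) s = dds I f' s"
    by (rule dds_cong) (auto intro: dds_eqI assms)
  also have "\<dots> = f''"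
    by (rule dds_eqI[OF assms(1,2,4)])
  finally show ?thesis .
qed

lemma has_vector_derivative_quotient:
  fixes f g :: "real \<Rightarrow> real"
  assumes "(f has_vector_derivative f') (at s within I)" "(g has_vector_derivative g') (at s within I)"
    "g s \<noteq> 0"
  shows "((\<lambda>t. f t / g t) has_vector_derivative (f' * g s - f s * g') / (g s * g s)) (at s within I)"
  using assms unfolding has_real_derivative_iff_has_vector_derivative[symmetric]
  by (rule DERIV_divide)

section \<open>Smooth functions on an interval\<close>

text \<open>
  Smoothness asks for all iterated derivatives at once, and so gives no induction hypothesis for the
  derivative of a product or of a composition. The finite orders do, because the derivative of a
  product of order \<open>n + 1\<close> is built from functions of order \<open>n\<close>.
\<close>

primrec smooth_upto :: "real set \<Rightarrow> nat \<Rightarrow> (real \<Rightarrow> 'a::real_normed_vector) \<Rightarrow> bool" where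
  "smooth_upto I 0 f \<longleftrightarrow> True"
| "smooth_upto I (Suc n) f \<longleftrightarrow>
     (\<forall>s\<in>I. f differentiable (at s within I)) \<and> smooth_upto I n (dds I f)"

lemma smooth_upto_iff:
  "smooth_upto I n f \<longleftrightarrow> (\<forall>m<n. \<forall>s\<in>I. ((dds I ^^ m) f) differentiable (at s within I))"
proof (induction n arbitrary: f)
  case (Suc n)
  have "(\<forall>m<Suc n. P m) \<longleftrightarrow> P 0 \<and> (\<forall>m<n. P (Suc m))" for P :: "nat \<Rightarrow> bool"
    by (auto simp: less_Suc_eq_0_disj)
  then show ?case
    by (simp add: Suc.IH funpow_swap1)
qed simp

lemma smooth_on_iff_smooth_upto: "smooth_on I f \<longleftrightarrow> (\<forall>n. smooth_upto I n f)"
  unfolding smooth_on_def smooth_upto_iff by blast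

lemma smooth_upto_SucD: "smooth_upto I (Suc n) f \<Longrightarrow> smooth_upto I n f"
  by (simp add: smooth_upto_iff less_SucI)

lemma smooth_upto_derivative:
  "smooth_upto I (Suc n) f \<Longrightarrow> s \<in> I \<Longrightarrow> (f has_vector_derivative dds I f s) (at s within I)"
  by (simp add: has_vector_derivative_dds)

lemma smooth_upto_cong:
  assumes "\<And>t. t \<in> I \<Longrightarrow> f t = g t"
  shows "smooth_upto I n f \<longleftrightarrow> smooth_upto I n g"
  using assms
proof (induction n arbitrary: f g)
  case (Suc n)
  have "f differentiable (at s within I) \<longleftrightarrow> g differentiable (at s within I)" if "s \<in> I" for s
    using has_vector_derivative_within_cong[of I f g s] Suc.prems that
    by (metis differentiableI_vector has_vector_derivative_dds)
  moreover have "smooth_upto I n (dds I f) \<longleftrightarrow> smooth_upto I n (dds I g)"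
    by (rule Suc.IH) (rule dds_cong[OF Suc.prems])
  ultimately show ?case
    by simp
qed simp

lemma smooth_upto_SucI:
  assumes "param_interval I" "\<And>s. s \<in> I \<Longrightarrow> (f has_vector_derivative f' s) (at s within I)"
    "smooth_upto I n f'"
  shows "smooth_upto I (Suc n) f"
proof -
  have "smooth_upto I n (dds I f) \<longleftrightarrow> smooth_upto I n f'"
    by (rule smooth_upto_cong) (auto intro: dds_eqI assms)
  then show ?thesis
    using assms by (auto intro: differentiableI_vector)
qed

lemma smooth_upto_add:
  assumes "param_interval I" "smooth_upto I n f" "smooth_upto I n g"
  shows "smooth_upto I n (\<lambda>s. f s + g s)"
  using assms(2,3)
proof (induction n arbitrary: f g)
  case (Suc n)
  show ?case
  proof (rule smooth_upto_SucI[OF assms(1)])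
    show "((\<lambda>s. f s + g s) has_vector_derivative dds I f s + dds I g s) (at s within I)"
      if "s \<in> I" for s
      by (intro has_vector_derivative_add smooth_upto_derivative[OF _ that, where n = n] Suc.prems)
    show "smooth_upto I n (\<lambda>s. dds I f s + dds I g s)"
      using Suc by simp
  qed
qed simp

lemma smooth_upto_bilinear:
  assumes "param_interval I" "bounded_bilinear h" "smooth_upto I n f" "smooth_upto I n g"
  shows "smooth_upto I n (\<lambda>s. h (f s) (g s))"
  using assms(3,4)
proof (induction n arbitrary: f g)
  case (Suc n)
  show ?case
  proof (rule smooth_upto_SucI[OF assms(1)])
    show "((\<lambda>s. h (f s) (g s)) has_vector_derivative h (f s) (dds I g s) + h (dds I f s) (g s))
        (at s within I)" if "s \<in> I" for s
      by (intro bounded_bilinear.has_vector_derivative[OF assms(2)]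
          smooth_upto_derivative[OF _ that, where n = n] Suc.prems)
    show "smooth_upto I n (\<lambda>s. h (f s) (dds I g s) + h (dds I f s) (g s))"
      using Suc.prems smooth_upto_SucD[OF Suc.prems(1)] smooth_upto_SucD[OF Suc.prems(2)]
      by (intro smooth_upto_add[OF assms(1)] Suc.IH) auto
  qed
qed simp

lemma smooth_upto_const:
  assumes "param_interval I"
  shows "smooth_upto I n (\<lambda>_. c)"
proof (induction n arbitrary: c)
  case (Suc n)
  show ?case
    by (rule smooth_upto_SucI[OF assms _ Suc]) (rule has_vector_derivative_const)
qed simp

lemma smooth_upto_inverse:
  fixes f :: "real \<Rightarrow> real"
  assumes "param_interval I" "\<forall>s\<in>I. f s \<noteq> 0" "smooth_upto I n f"
  shows "smooth_upto I n (\<lambda>s. inverse (f s))"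
  using assms(3)
proof (induction n)
  case (Suc n)
  let ?g = "\<lambda>s. inverse (f s)"
  have g: "smooth_upto I n ?g"
    using Suc by (blast dest: smooth_upto_SucD)
  note mult = smooth_upto_bilinear[OF assms(1) bounded_bilinear_mult]
  show ?case
  proof (rule smooth_upto_SucI[OF assms(1)])
    show "(?g has_vector_derivative dds I f s * (-1 * (?g s * ?g s))) (at s within I)"
      if "s \<in> I" for s
      using smooth_upto_derivative[OF Suc.prems that] assms(2) that
      unfolding has_real_derivative_iff_has_vector_derivative[symmetric]
      by (auto intro!: derivative_eq_intros)
    show "smooth_upto I n (\<lambda>s. dds I f s * (-1 * (?g s * ?g s)))"
      using Suc.prems by (intro mult g smooth_upto_const[OF assms(1)]) simp
  qed
qed simp

lemma smooth_upto_sqrt: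
  fixes f :: "real \<Rightarrow> real"
  assumes "param_interval I" "\<forall>s\<in>I. f s > 0" "smooth_upto I n f"
  shows "smooth_upto I n (\<lambda>s. sqrt (f s))"
  using assms(3)
proof (induction n)
  case (Suc n)
  have g: "smooth_upto I n (\<lambda>s. sqrt (f s))"
    using Suc by (blast dest: smooth_upto_SucD)
  show ?case
  proof (rule smooth_upto_SucI[OF assms(1)])
    show "((\<lambda>s. sqrt (f s)) has_vector_derivative dds I f s * (1 / 2 * inverse (sqrt (f s))))
        (at s within I)" if "s \<in> I" for s
    proof -
      have "f s > 0"
        using assms(2) that by blast
      then show ?thesis
        using smooth_upto_derivative[OF Suc.prems that]
        unfolding has_real_derivative_iff_has_vector_derivative[symmetric]
        by (auto intro!: derivative_eq_intros simp: field_simps)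
    qed
    have "\<forall>s\<in>I. sqrt (f s) \<noteq> 0"
      using assms(2) by force
    then show "smooth_upto I n (\<lambda>s. dds I f s * (1 / 2 * inverse (sqrt (f s))))"
      using Suc.prems
      by (intro smooth_upto_bilinear[OF assms(1) bounded_bilinear_mult]
          smooth_upto_inverse[OF assms(1)] smooth_upto_const[OF assms(1)] g) auto
  qed
qed simp

lemma smooth_on_derivative:
  "smooth_on I f \<Longrightarrow> s \<in> I \<Longrightarrow> (f has_vector_derivative dds I f s) (at s within I)"
  unfolding smooth_on_iff_smooth_upto by (blast intro: smooth_upto_derivative)

lemma smooth_on_dds: "smooth_on I f \<Longrightarrow> smooth_on I (dds I f)"
  unfolding smooth_on_iff_smooth_upto by (metis smooth_upto.simps(2))

lemma smooth_on_cong: "(\<And>t. t \<in> I \<Longrightarrow> f t = g t) \<Longrightarrow> smooth_on I f \<longleftrightarrow> smooth_on I g"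
  unfolding smooth_on_iff_smooth_upto using smooth_upto_cong by blast

lemma smooth_on_add:
  "param_interval I \<Longrightarrow> smooth_on I f \<Longrightarrow> smooth_on I g \<Longrightarrow> smooth_on I (\<lambda>s. f s + g s)"
  unfolding smooth_on_iff_smooth_upto by (blast intro: smooth_upto_add)

lemma smooth_on_bilinear:
  "param_interval I \<Longrightarrow> bounded_bilinear h \<Longrightarrow> smooth_on I f \<Longrightarrow> smooth_on I g \<Longrightarrow>
    smooth_on I (\<lambda>s. h (f s) (g s))"
  unfolding smooth_on_iff_smooth_upto by (blast intro: smooth_upto_bilinear)

lemmas smooth_on_mult = smooth_on_bilinear[OF _ bounded_bilinear_mult]
  and smooth_on_scaleR = smooth_on_bilinear[OF _ bounded_bilinear_scaleR]
  and smooth_on_inner = smooth_on_bilinear[OF _ bounded_bilinear_inner]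

lemma bounded_bilinear_cross3: "bounded_bilinear cross3"
  using bilinear_cross bilinear_conv_bounded_bilinear by blast

lemmas smooth_on_cross3 = smooth_on_bilinear[OF _ bounded_bilinear_cross3]

lemma smooth_on_divide:
  fixes f g :: "real \<Rightarrow> real"
  assumes "param_interval I" "\<forall>s\<in>I. g s \<noteq> 0" "smooth_on I f" "smooth_on I g"
  shows "smooth_on I (\<lambda>s. f s / g s)"
proof -
  have "smooth_on I (\<lambda>s. inverse (g s))"
    using assms unfolding smooth_on_iff_smooth_upto by (blast intro: smooth_upto_inverse)
  then show ?thesis
    unfolding divide_inverse by (rule smooth_on_mult[OF assms(1,3)])
qed

lemma smooth_on_sqrt:
  fixes f :: "real \<Rightarrow> real"
  shows "param_interval I \<Longrightarrow> \<forall>s\<in>I. f s > 0 \<Longrightarrow> smooth_on I f \<Longrightarrow> smooth_on I (\<lambda>s. sqrt (f s))"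
  unfolding smooth_on_iff_smooth_upto by (blast intro: smooth_upto_sqrt)

lemma smooth_on_const: "param_interval I \<Longrightarrow> smooth_on I (\<lambda>_. c)"
  unfolding smooth_on_iff_smooth_upto by (blast intro: smooth_upto_const)

lemma inner_derivative_of_const:
  assumes "param_interval I" "s \<in> I" "\<And>t. t \<in> I \<Longrightarrow> f t \<bullet> g t = c"
    "(f has_vector_derivative f') (at s within I)" "(g has_vector_derivative g') (at s within I)"
  shows "f s \<bullet> g' + f' \<bullet> g s = 0"
proof -
  have "dds I (\<lambda>t. f t \<bullet> g t) s = f s \<bullet> g' + f' \<bullet> g s"
    by (rule dds_eqI[OF assms(1,2) bounded_bilinear.has_vector_derivative
          [OF bounded_bilinear_inner assms(4,5)]])
  moreover have "dds I (\<lambda>t. f t \<bullet> g t) s = dds I (\<lambda>_. c) s"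
    by (rule dds_cong[OF assms(3,2)])
  moreover have "dds I (\<lambda>_. c) s = 0"
    by (rule dds_eqI[OF assms(1,2) has_vector_derivative_const])
  ultimately show ?thesis
    by simp
qed

section \<open>The Frenet-type frame\<close>

lemma inner_cross3_self: "x \<bullet> cross3 x y = 0" "y \<bullet> cross3 x y = 0"
  by (simp_all add: inner_commute dot_cross_self)

lemma orthonormal_cross3_frame:
  fixes e f :: "real^3"
  assumes "norm e = 1" "norm f = 1" "e \<bullet> f = 0"
  shows "norm (cross3 e f) = 1" "cross3 e (cross3 e f) = - f" "cross3 f (cross3 e f) = e"
proof -
  have "(norm (cross3 e f))\<^sup>2 = 1"
    using norm_cross[of e f] assms by simp
  then show "norm (cross3 e f) = 1"
    by (simp add: power2_eq_1_iff) (smt (verit) norm_ge_zero)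
  have "e \<bullet> e = 1" "f \<bullet> f = 1" "f \<bullet> e = 0"
    using assms by (simp_all add: norm_eq_1 inner_commute)
  then show "cross3 e (cross3 e f) = - f" "cross3 f (cross3 e f) = e"
    using assms(3) by (simp_all add: Lagrange)
qed

text \<open>
  The remainder \<open>w\<close> after subtracting the two projections is orthogonal to \<open>e\<close>, \<open>f\<close> and
  \<open>g = e \<times> f\<close>. By the triple product formula \<open>w \<times> g = 0\<close>, while \<open>w \<bullet> g = 0\<close> gives
  \<open>\<parallel>w \<times> g\<parallel> = \<parallel>w\<parallel>\<close>; so \<open>w = 0\<close>.
\<close>

lemma orthogonal_complement_expansion:
  fixes e f v :: "real^3"
  assumes "norm e = 1" "norm f = 1" "e \<bullet> f = 0" "v \<bullet> f = 0"
  shows "v = (v \<bullet> e) *\<^sub>R e + (v \<bullet> cross3 e f) *\<^sub>R cross3 e f"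
proof -
  define g where "g = cross3 e f"
  define w where "w = v - (v \<bullet> e) *\<^sub>R e - (v \<bullet> g) *\<^sub>R g"
  have g: "norm g = 1" "e \<bullet> g = 0" "f \<bullet> g = 0"
    using orthonormal_cross3_frame[OF assms(1-3)] inner_cross3_self by (auto simp: g_def)
  have "w \<bullet> e = 0" "w \<bullet> f = 0" "w \<bullet> g = 0"
    using assms g by (simp_all add: w_def inner_diff_left inner_diff_right inner_commute norm_eq_1)
  moreover from this have "cross3 w g = 0"
    by (simp add: g_def Lagrange)
  ultimately have "(norm w)\<^sup>2 = 0"
    using norm_cross[of w g] g by simp
  then show ?thesis
    by (simp add: w_def g_def algebra_simps)
qed

text \<open>
  The torsion is introduced as the unique solution of the second Frenet-type equation. A solution
  exists because differentiating \<open>\<xi>\<^sub>2 \<bullet> \<xi>\<^sub>2 = 1\<close> and \<open>\<xi> \<bullet> \<xi>\<^sub>2 = 0\<close> fixes the first two components of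
  \<open>\<xi>\<^sub>2'\<close>; being the third component, the solution is also smooth.
\<close>

lemma frenet_frame:
  assumes I: "param_interval I" and \<xi>: "unit_field I \<xi>" and K1_pos: "\<forall>s\<in>I. K1 I \<xi> s > 0"
  shows smooth_K1: "smooth_on I (K1 I \<xi>)"
    and smooth_xi2: "smooth_on I (xi2 I \<xi>)"
    and smooth_K2: "smooth_on I (K2 I \<xi>)"
    and norm_xi2: "s \<in> I \<Longrightarrow> norm (xi2 I \<xi> s) = 1"
    and inner_xi_xi2: "s \<in> I \<Longrightarrow> \<xi> s \<bullet> xi2 I \<xi> s = 0"
    and xi_derivative: "s \<in> I \<Longrightarrow> (\<xi> has_vector_derivative K1 I \<xi> s *\<^sub>R xi2 I \<xi> s) (at s within I)"
    and dds_xi2: "s \<in> I \<Longrightarrow> dds I (xi2 I \<xi>) s = - (K1 I \<xi> s *\<^sub>R \<xi> s) + K2 I \<xi> s *\<^sub>R xi3 I \<xi> s"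
    and xi3_derivative:
      "s \<in> I \<Longrightarrow> (xi3 I \<xi> has_vector_derivative - (K2 I \<xi> s *\<^sub>R xi2 I \<xi> s)) (at s within I)"
proof -
  let ?K1 = "K1 I \<xi>" and ?K2 = "K2 I \<xi>" and ?\<xi>2 = "xi2 I \<xi>" and ?\<xi>3 = "xi3 I \<xi>"
  have smooth_\<xi>: "smooth_on I \<xi>" and norm_\<xi>: "\<And>s. s \<in> I \<Longrightarrow> norm (\<xi> s) = 1"
    using \<xi> by (auto simp: unit_field_def)
  show K1: "smooth_on I ?K1"
    unfolding K1_def[abs_def] norm_eq_sqrt_inner
    using K1_pos
    by (intro smooth_on_sqrt smooth_on_inner smooth_on_dds smooth_\<xi> I)
      (auto simp: K1_def norm_eq_sqrt_inner)
  show \<xi>2: "smooth_on I ?\<xi>2"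
    unfolding xi2_def[abs_def]
    using K1_pos
    by (intro smooth_on_scaleR smooth_on_divide smooth_on_const smooth_on_dds smooth_\<xi> K1 I) auto
  show norm_\<xi>2: "norm (?\<xi>2 s) = 1" if "s \<in> I" for s
    using K1_pos that by (auto simp: xi2_def K1_def)
  show d\<xi>: "(\<xi> has_vector_derivative ?K1 s *\<^sub>R ?\<xi>2 s) (at s within I)" if "s \<in> I" for s
    using smooth_on_derivative[OF smooth_\<xi> that] K1_pos that by (auto simp: xi2_def)
  show perp: "\<xi> s \<bullet> ?\<xi>2 s = 0" if "s \<in> I" for s
  proof -
    have "\<xi> s \<bullet> (?K1 s *\<^sub>R ?\<xi>2 s) + (?K1 s *\<^sub>R ?\<xi>2 s) \<bullet> \<xi> s = 0"
      using norm_\<xi> by (intro inner_derivative_of_const[OF I that _ d\<xi>[OF that] d\<xi>[OF that]])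
        (auto simp: norm_eq_1)
    then show ?thesis
      using K1_pos that by (auto simp: inner_commute)
  qed
  have frame: "norm (?\<xi>3 s) = 1" "cross3 (\<xi> s) (?\<xi>3 s) = - ?\<xi>2 s" if "s \<in> I" for s
    using orthonormal_cross3_frame[OF norm_\<xi> norm_\<xi>2 perp] that by (auto simp: xi3_def)
  note d\<xi>2 = smooth_on_derivative[OF \<xi>2]
  have second_equation: "dds I ?\<xi>2 s = - (?K1 s *\<^sub>R \<xi> s) + (dds I ?\<xi>2 s \<bullet> ?\<xi>3 s) *\<^sub>R ?\<xi>3 s"
    if s: "s \<in> I" for s
  proof -
    have "?\<xi>2 s \<bullet> dds I ?\<xi>2 s + dds I ?\<xi>2 s \<bullet> ?\<xi>2 s = 0"
      using norm_\<xi>2 by (intro inner_derivative_of_const[OF I s _ d\<xi>2[OF s] d\<xi>2[OF s]])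
        (auto simp: norm_eq_1)
    then have "dds I ?\<xi>2 s \<bullet> ?\<xi>2 s = 0"
      by (simp add: inner_commute)
    moreover have "\<xi> s \<bullet> dds I ?\<xi>2 s + (?K1 s *\<^sub>R ?\<xi>2 s) \<bullet> ?\<xi>2 s = 0"
      by (rule inner_derivative_of_const[OF I s perp d\<xi>[OF s] d\<xi>2[OF s]])
    then have "dds I ?\<xi>2 s \<bullet> \<xi> s = - ?K1 s"
      using norm_\<xi>2[OF s] by (simp add: inner_commute norm_eq_1)
    ultimately show ?thesis
      using orthogonal_complement_expansion[OF norm_\<xi> norm_\<xi>2 perp, OF s s s, of "dds I ?\<xi>2 s"]
      by (simp add: xi3_def)
  qed
  have K2_eq: "?K2 s = dds I ?\<xi>2 s \<bullet> ?\<xi>3 s" if s: "s \<in> I" for s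
    unfolding K2_def
  proof (rule the_equality)
    show "dds I ?\<xi>2 s = - (?K1 s *\<^sub>R \<xi> s) + (dds I ?\<xi>2 s \<bullet> ?\<xi>3 s) *\<^sub>R ?\<xi>3 s"
      by (rule second_equation[OF s])
    fix k
    assume k: "dds I ?\<xi>2 s = - (?K1 s *\<^sub>R \<xi> s) + k *\<^sub>R ?\<xi>3 s"
    have "\<xi> s \<bullet> ?\<xi>3 s = 0"
      by (simp add: xi3_def inner_cross3_self)
    then show "k = dds I ?\<xi>2 s \<bullet> ?\<xi>3 s"
      using frame(1)[OF s] by (simp add: k inner_add_left inner_diff_left norm_eq_1)
  qed
  have "smooth_on I ?\<xi>3"
    unfolding xi3_def[abs_def] by (intro smooth_on_cross3 smooth_\<xi> \<xi>2 I)
  then have "smooth_on I (\<lambda>s. dds I ?\<xi>2 s \<bullet> ?\<xi>3 s)"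
    by (intro smooth_on_inner smooth_on_dds \<xi>2 I)
  then show "smooth_on I ?K2"
    by (subst smooth_on_cong[OF K2_eq])
  show dds_\<xi>2: "dds I ?\<xi>2 s = - (?K1 s *\<^sub>R \<xi> s) + ?K2 s *\<^sub>R ?\<xi>3 s" if "s \<in> I" for s
    using second_equation[OF that] K2_eq[OF that] by simp
  show "(?\<xi>3 has_vector_derivative - (?K2 s *\<^sub>R ?\<xi>2 s)) (at s within I)" if s: "s \<in> I" for s
  proof -
    have "(?\<xi>3 has_vector_derivative
        cross3 (\<xi> s) (dds I ?\<xi>2 s) + cross3 (?K1 s *\<^sub>R ?\<xi>2 s) (?\<xi>2 s)) (at s within I)"
      unfolding xi3_def[abs_def]
      by (rule bounded_bilinear.has_vector_derivative[OF bounded_bilinear_cross3 d\<xi>[OF s] d\<xi>2[OF s]])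
    also have "cross3 (\<xi> s) (dds I ?\<xi>2 s) + cross3 (?K1 s *\<^sub>R ?\<xi>2 s) (?\<xi>2 s) = - (?K2 s *\<^sub>R ?\<xi>2 s)"
      unfolding dds_\<xi>2[OF s] cross_add_right cross_minus_right cross_mult_right cross_mult_left
      by (simp add: frame(2)[OF s])
    finally show ?thesis .
  qed
qed

section \<open>The alternative frame\<close>

text \<open>
  The velocity of a point \<open>(a, b)\<close> of the unit circle is a multiple of the unit tangent \<open>(b, - a)\<close>;
  the factor \<open>w = a' b - a b'\<close> is the clockwise angular velocity, which the quotient rule turns into
  \<open>b\<^sup>2 (a/b)'\<close>. For \<open>a = K\<^sub>2/p\<close> and \<open>b = K\<^sub>1/p\<close> this is the formula that defines \<open>q\<close>.
\<close>

lemma unit_circle_derivative: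
  fixes a b :: "real \<Rightarrow> real"
  assumes I: "param_interval I" and s: "s \<in> I"
    and circle: "\<And>t. t \<in> I \<Longrightarrow> (a t)\<^sup>2 + (b t)\<^sup>2 = 1"
    and a: "(a has_vector_derivative a') (at s within I)"
    and b: "(b has_vector_derivative b') (at s within I)" and "b s \<noteq> 0"
  defines "w \<equiv> (b s)\<^sup>2 * dds I (\<lambda>t. a t / b t) s"
  shows "a' = w * b s" "b' = - (w * a s)"
proof -
  have w: "w = a' * b s - a s * b'"
    unfolding w_def dds_eqI[OF I s has_vector_derivative_quotient[OF a b \<open>b s \<noteq> 0\<close>]]
    using \<open>b s \<noteq> 0\<close> by (simp add: power2_eq_square)
  have "((\<lambda>t. (a t)\<^sup>2 + (b t)\<^sup>2) has_vector_derivative 2 * (a s * a' + b s * b')) (at s within I)"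
    using a b unfolding has_real_derivative_iff_has_vector_derivative[symmetric]
    by (auto intro!: derivative_eq_intros)
  from dds_eqI[OF I s this] have "dds I (\<lambda>t. (a t)\<^sup>2 + (b t)\<^sup>2) s = 2 * (a s * a' + b s * b')" .
  moreover have "dds I (\<lambda>t. (a t)\<^sup>2 + (b t)\<^sup>2) s = dds I (\<lambda>_. 1) s"
    by (intro dds_cong circle s)
  moreover have "dds I (\<lambda>_. 1::real) s = 0"
    by (rule dds_eqI[OF I s has_vector_derivative_const])
  ultimately have tangent: "a s * a' + b s * b' = 0"
    by simp
  have "w * b s = a' * ((a s)\<^sup>2 + (b s)\<^sup>2) - a s * (a s * a' + b s * b')"
    "- (w * a s) = b' * ((a s)\<^sup>2 + (b s)\<^sup>2) - b s * (a s * a' + b s * b')"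
    unfolding w by algebra+
  then show "a' = w * b s" "b' = - (w * a s)"
    using tangent circle[OF s] by simp_all
qed

text \<open>
  In the coordinates \<open>a = K\<^sub>2/p\<close>, \<open>b = K\<^sub>1/p\<close> the derivatives of \<open>a\<close> and \<open>b\<close> produce the \<open>q\<close>-terms.
  The derivatives of \<open>\<xi>\<close> and \<open>\<xi>\<^sub>3\<close> contribute only along \<open>\<xi>\<^sub>2\<close>: with total weight
  \<open>- (b K\<^sub>1 + a K\<^sub>2) = - p\<close> in \<open>Y'\<close> and with \<open>a K\<^sub>1 - b K\<^sub>2 = 0\<close> in \<open>D'\<close>.
\<close>

lemma alternative_frame:
  assumes I: "param_interval I" and \<xi>: "unit_field I \<xi>" and K1_pos: "\<forall>s\<in>I. K1 I \<xi> s > 0"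
  shows smooth_alt_p: "smooth_on I (alt_p I \<xi>)"
    and smooth_alt_q: "smooth_on I (alt_q I \<xi>)"
    and xi2_derivative:
      "s \<in> I \<Longrightarrow> (xi2 I \<xi> has_vector_derivative alt_p I \<xi> s *\<^sub>R alt_Y I \<xi> s) (at s within I)"
    and alt_Y_derivative:
      "s \<in> I \<Longrightarrow> (alt_Y I \<xi> has_vector_derivative
         - (alt_p I \<xi> s *\<^sub>R xi2 I \<xi> s) + alt_q I \<xi> s *\<^sub>R alt_D I \<xi> s) (at s within I)"
    and alt_D_derivative:
      "s \<in> I \<Longrightarrow> (alt_D I \<xi> has_vector_derivative - (alt_q I \<xi> s *\<^sub>R alt_Y I \<xi> s)) (at s within I)"
proof -
  let ?K1 = "K1 I \<xi>" and ?K2 = "K2 I \<xi>" and ?\<xi>2 = "xi2 I \<xi>" and ?\<xi>3 = "xi3 I \<xi>"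
  let ?p = "alt_p I \<xi>" and ?q = "alt_q I \<xi>" and ?Y = "alt_Y I \<xi>" and ?D = "alt_D I \<xi>"
  note K1 = smooth_K1[OF assms] and K2 = smooth_K2[OF assms]
  have pos: "(?K1 s)\<^sup>2 + (?K2 s)\<^sup>2 > 0" if "s \<in> I" for s
    using K1_pos that by (force intro: add_pos_nonneg)
  have p_pos: "?p s > 0" and p_sq: "(?p s)\<^sup>2 = (?K1 s)\<^sup>2 + (?K2 s)\<^sup>2" if "s \<in> I" for s
    using pos[OF that] by (simp_all add: alt_p_def)
  have sq: "smooth_on I (\<lambda>s. (?K1 s)\<^sup>2 + (?K2 s)\<^sup>2)"
    unfolding power2_eq_square by (intro smooth_on_add smooth_on_mult K1 K2 I)
  show p: "smooth_on I ?p"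
    unfolding alt_p_def[abs_def] using pos by (intro smooth_on_sqrt sq I) auto
  have "smooth_on I (\<lambda>s. (?K1 s)\<^sup>2)"
    unfolding power2_eq_square by (intro smooth_on_mult K1 I)
  then show "smooth_on I ?q"
    unfolding alt_q_def[abs_def] using pos K1_pos
    by (intro smooth_on_mult smooth_on_divide smooth_on_dds K1 K2 sq I) force+

  define a where "a s = ?K2 s / ?p s" for s
  define b where "b s = ?K1 s / ?p s" for s
  have smooth_ab: "smooth_on I a" "smooth_on I b"
    unfolding a_def[abs_def] b_def[abs_def] using p_pos
    by (intro smooth_on_divide K1 K2 p I; force)+
  have circle: "(a s)\<^sup>2 + (b s)\<^sup>2 = 1" if "s \<in> I" for s
    using p_sq[OF that] p_pos[OF that]
    by (simp add: a_def b_def power_divide add.commute flip: add_divide_distrib p_sq[OF that])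
  have pa: "?p s * a s = ?K2 s" and pb: "?p s * b s = ?K1 s" and b_pos: "b s > 0" if "s \<in> I" for s
    using p_pos[OF that] K1_pos that by (simp_all add: a_def b_def)
  have q: "?q s = (b s)\<^sup>2 * dds I (\<lambda>t. a t / b t) s" if "s \<in> I" for s
  proof -
    have "dds I (\<lambda>t. a t / b t) s = dds I (\<lambda>t. ?K2 t / ?K1 t) s"
      using p_pos by (intro dds_cong[OF _ that]) (force simp: a_def b_def)
    then show ?thesis
      using p_sq[OF that] by (simp add: alt_q_def b_def power_divide)
  qed
  have da: "(a has_vector_derivative ?q s * b s) (at s within I)"
    and db: "(b has_vector_derivative - (?q s * a s)) (at s within I)" if s: "s \<in> I" for s
    using unit_circle_derivative[OF I s circle smooth_on_derivative[OF smooth_ab(1) s]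
        smooth_on_derivative[OF smooth_ab(2) s]] b_pos[OF s] q[OF s]
      smooth_on_derivative[OF smooth_ab(1) s] smooth_on_derivative[OF smooth_ab(2) s]
    by auto

  have frame: "\<xi> s \<bullet> ?\<xi>3 s = 0" "\<xi> s \<bullet> \<xi> s = 1" "?\<xi>3 s \<bullet> ?\<xi>3 s = 1"
    "cross3 (?\<xi>2 s) (\<xi> s) = - ?\<xi>3 s" "cross3 (?\<xi>2 s) (?\<xi>3 s) = \<xi> s" if "s \<in> I" for s
  proof -
    have "norm (\<xi> s) = 1"
      using \<xi> that by (simp add: unit_field_def)
    note orthonormal_cross3_frame[OF this norm_xi2[OF assms that] inner_xi_xi2[OF assms that]]
    then show "\<xi> s \<bullet> ?\<xi>3 s = 0" "\<xi> s \<bullet> \<xi> s = 1" "?\<xi>3 s \<bullet> ?\<xi>3 s = 1"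
      "cross3 (?\<xi>2 s) (\<xi> s) = - ?\<xi>3 s" "cross3 (?\<xi>2 s) (?\<xi>3 s) = \<xi> s"
      using \<open>norm (\<xi> s) = 1\<close>
      by (simp_all add: xi3_def inner_cross3_self norm_eq_1 flip: cross_skew)
  qed
  have dds_\<xi>2: "dds I ?\<xi>2 s = ?p s *\<^sub>R (- (b s *\<^sub>R \<xi> s) + a s *\<^sub>R ?\<xi>3 s)" if "s \<in> I" for s
    using dds_xi2[OF assms that] pa[OF that] pb[OF that] by (simp add: algebra_simps)
  have norm_dds_\<xi>2: "norm (dds I ?\<xi>2 s) = ?p s" if "s \<in> I" for s
  proof -
    have "(norm (- (b s *\<^sub>R \<xi> s) + a s *\<^sub>R ?\<xi>3 s))\<^sup>2 = 1"
      using frame[OF that] circle[OF that]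
      unfolding power2_norm_eq_inner
      by (simp add: inner_diff_left inner_diff_right inner_commute power2_eq_square)
    then have "norm (- (b s *\<^sub>R \<xi> s) + a s *\<^sub>R ?\<xi>3 s) = 1"
      by (simp add: power2_eq_1_iff) (smt (verit) norm_ge_zero)
    then show ?thesis
      using p_pos[OF that] by (simp add: dds_\<xi>2[OF that])
  qed
  have Y: "?Y s = - (b s *\<^sub>R \<xi> s) + a s *\<^sub>R ?\<xi>3 s" if "s \<in> I" for s
    unfolding alt_Y_def norm_dds_\<xi>2[OF that] using p_pos[OF that] by (simp add: dds_\<xi>2[OF that])
  have D: "?D s = a s *\<^sub>R \<xi> s + b s *\<^sub>R ?\<xi>3 s" if "s \<in> I" for s
    unfolding alt_D_def Y[OF that] cross_add_right cross_minus_right cross_mult_right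
    by (simp add: frame[OF that])

  show "(?\<xi>2 has_vector_derivative ?p s *\<^sub>R ?Y s) (at s within I)" if "s \<in> I" for s
    using smooth_on_derivative[OF smooth_xi2[OF assms] that] dds_\<xi>2[OF that] Y[OF that] by simp

  note scaleR_derivative = bounded_bilinear.has_vector_derivative[OF bounded_bilinear_scaleR]
  note d\<xi> = xi_derivative[OF assms] and d\<xi>3 = xi3_derivative[OF assms]
  show "(?Y has_vector_derivative - (?p s *\<^sub>R ?\<xi>2 s) + ?q s *\<^sub>R ?D s) (at s within I)" if s: "s \<in> I" for s
  proof -
    have "((\<lambda>s. - (b s *\<^sub>R \<xi> s) + a s *\<^sub>R ?\<xi>3 s) has_vector_derivative
        - (b s *\<^sub>R ?K1 s *\<^sub>R ?\<xi>2 s + (- (?q s * a s)) *\<^sub>R \<xi> s) +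
          (a s *\<^sub>R (- (?K2 s *\<^sub>R ?\<xi>2 s)) + (?q s * b s) *\<^sub>R ?\<xi>3 s)) (at s within I)"
      by (intro has_vector_derivative_add has_vector_derivative_minus scaleR_derivative
          da[OF s] db[OF s] d\<xi>[OF s] d\<xi>3[OF s])
    also have "- (b s *\<^sub>R ?K1 s *\<^sub>R ?\<xi>2 s + (- (?q s * a s)) *\<^sub>R \<xi> s) +
          (a s *\<^sub>R (- (?K2 s *\<^sub>R ?\<xi>2 s)) + (?q s * b s) *\<^sub>R ?\<xi>3 s) =
        - ((?p s * ((a s)\<^sup>2 + (b s)\<^sup>2)) *\<^sub>R ?\<xi>2 s) + ?q s *\<^sub>R ?D s"
      unfolding D[OF s] pa[OF s, symmetric] pb[OF s, symmetric]
      by (simp add: algebra_simps power2_eq_square)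
    finally show ?thesis
      using has_vector_derivative_within_cong[where f = ?Y, OF Y s] circle[OF s] by simp
  qed
  show "(?D has_vector_derivative - (?q s *\<^sub>R ?Y s)) (at s within I)" if s: "s \<in> I" for s
  proof -
    have "((\<lambda>s. a s *\<^sub>R \<xi> s + b s *\<^sub>R ?\<xi>3 s) has_vector_derivative
        (a s *\<^sub>R ?K1 s *\<^sub>R ?\<xi>2 s + (?q s * b s) *\<^sub>R \<xi> s) +
          (b s *\<^sub>R (- (?K2 s *\<^sub>R ?\<xi>2 s)) + (- (?q s * a s)) *\<^sub>R ?\<xi>3 s)) (at s within I)"
      by (intro has_vector_derivative_add scaleR_derivative da[OF s] db[OF s] d\<xi>[OF s] d\<xi>3[OF s])
    also have "(a s *\<^sub>R ?K1 s *\<^sub>R ?\<xi>2 s + (?q s * b s) *\<^sub>R \<xi> s) +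
          (b s *\<^sub>R (- (?K2 s *\<^sub>R ?\<xi>2 s)) + (- (?q s * a s)) *\<^sub>R ?\<xi>3 s) = - (?q s *\<^sub>R ?Y s)"
      unfolding Y[OF s] pa[OF s, symmetric] pb[OF s, symmetric] by (simp add: algebra_simps)
    finally show ?thesis
      using has_vector_derivative_within_cong[where f = ?D, OF D s] by simp
  qed
qed

section \<open>The differential equation of the third frame vector\<close>

text \<open>
  Once \<open>D'\<close>, \<open>D''\<close> and \<open>D'''\<close> are written in terms of \<open>X\<close>, \<open>Y\<close>, \<open>D\<close>, the coefficient of \<open>D''\<close>
  is what it takes to cancel \<open>X\<close>, then that of \<open>D'\<close> cancels \<open>Y\<close>, and that of \<open>D\<close> cancels the rest.
  Each step is an identity between \<open>p\<close>, \<open>q\<close>, \<open>p'\<close>, \<open>q'\<close> and \<open>q''\<close>, so the equation holds for the third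
  vector of any frame that moves by these formulas.
\<close>

lemma third_frame_vector_ode:
  fixes X Y D :: "real \<Rightarrow> 'a::real_normed_vector" and p q :: "real \<Rightarrow> real"
  assumes I: "param_interval I" and p: "smooth_on I p" and q: "smooth_on I q"
    and nz: "\<forall>s\<in>I. p s \<noteq> 0 \<and> q s \<noteq> 0"
    and X': "\<And>s. s \<in> I \<Longrightarrow> (X has_vector_derivative p s *\<^sub>R Y s) (at s within I)"
    and Y': "\<And>s. s \<in> I \<Longrightarrow> (Y has_vector_derivative - (p s *\<^sub>R X s) + q s *\<^sub>R D s) (at s within I)"
    and D': "\<And>s. s \<in> I \<Longrightarrow> (D has_vector_derivative - (q s *\<^sub>R Y s)) (at s within I)"
    and s: "s \<in> I"
  shows "dds I (dds I (dds I D)) s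
    - (dds I (\<lambda>t. p t * q t) s / (p s * q s) + dds I q s / q s) *\<^sub>R dds I (dds I D) s
    + (p s * q s * dds I (\<lambda>t. 1 / p t * dds I (\<lambda>u. 1 / q u) t) s + (p s)\<^sup>2 + (q s)\<^sup>2) *\<^sub>R dds I D s
    + (p s * q s * dds I (\<lambda>t. q t / p t) s) *\<^sub>R D s = 0"
proof -
  let ?p' = "dds I p" and ?q' = "dds I q"
  let ?q'' = "dds I ?q'"
  note real = has_real_derivative_iff_has_vector_derivative[symmetric]
  note scaleR_derivative = bounded_bilinear.has_vector_derivative[OF bounded_bilinear_scaleR]
  have dp: "(p has_vector_derivative ?p' t) (at t within I)"
    and dq: "(q has_vector_derivative ?q' t) (at t within I)"
    and dq': "(?q' has_vector_derivative ?q'' t) (at t within I)" if "t \<in> I" for t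
    using smooth_on_derivative[OF _ that] p q smooth_on_dds by blast+
  \<comment> \<open>The derivatives of \<open>p q\<close> and \<open>q\<^sup>2\<close> stay folded while vectors are collected; they are expanded
    only in the scalar identities.\<close>
  define pq' where "pq' = ?p' s * q s + p s * ?q' s"
  define qq' where "qq' = 2 * q s * ?q' s"
  have dpq: "((\<lambda>t. p t * q t) has_vector_derivative pq') (at s within I)"
    using dp[OF s] dq[OF s] unfolding real pq'_def by (auto intro!: derivative_eq_intros)
  have dqq: "((\<lambda>t. - (q t * q t)) has_vector_derivative - qq') (at s within I)"
    using dq[OF s] unfolding real qq'_def by (auto intro!: derivative_eq_intros)
  have q_over_p: "dds I (\<lambda>t. q t / p t) s = (?q' s * p s - q s * ?p' s) / (p s * p s)"
    using nz s by (intro dds_eqI[OF I s] has_vector_derivative_quotient dp dq) auto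
  have inv_q: "dds I (\<lambda>u. 1 / q u) t = - (?q' t / (q t * q t))" if t: "t \<in> I" for t
  proof -
    have "dds I (\<lambda>u. 1 / q u) t = (0 * q t - 1 * ?q' t) / (q t * q t)"
      using nz t by (intro dds_eqI[OF I t] has_vector_derivative_quotient dq
          has_vector_derivative_const) auto
    then show ?thesis
      by simp
  qed
  have dpqq: "((\<lambda>t. p t * (q t * q t)) has_vector_derivative
      ?p' s * (q s * q s) + p s * (2 * q s * ?q' s)) (at s within I)"
    using dp[OF s] dq[OF s] unfolding real
    by (auto intro!: derivative_eq_intros)
  have inv_p_inv_q: "dds I (\<lambda>t. 1 / p t * dds I (\<lambda>u. 1 / q u) t) s =
      - ((?q'' s * (p s * (q s * q s)) - ?q' s * (?p' s * (q s * q s) + p s * (2 * q s * ?q' s)))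
         / (p s * (q s * q s) * (p s * (q s * q s))))"
  proof -
    have "dds I (\<lambda>t. 1 / p t * dds I (\<lambda>u. 1 / q u) t) s =
        dds I (\<lambda>t. - (?q' t / (p t * (q t * q t)))) s"
      by (rule dds_cong[OF _ s]) (simp add: inv_q)
    also have "\<dots> = - ((?q'' s * (p s * (q s * q s)) -
        ?q' s * (?p' s * (q s * q s) + p s * (2 * q s * ?q' s)))
         / (p s * (q s * q s) * (p s * (q s * q s))))"
      using nz s
      by (intro dds_eqI[OF I s] has_vector_derivative_minus has_vector_derivative_quotient dq' dpqq)
        auto
    finally show ?thesis .
  qed

  \<comment> \<open>The formula for \<open>D''\<close>, as a function on the whole interval so that it can be differentiated
    once more; signs are part of the scalar factors so that the product rule for \<open>*\<^sub>R\<close> applies.\<close>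
  define D2 where "D2 t = (p t * q t) *\<^sub>R X t + (- ?q' t) *\<^sub>R Y t + (- (q t * q t)) *\<^sub>R D t" for t
  have D1: "dds I D s = - (q s *\<^sub>R Y s)"
    by (rule dds_eqI[OF I s D'[OF s]])
  have dds_D: "dds I (dds I D) t = D2 t" if t: "t \<in> I" for t
  proof -
    have "((\<lambda>t. - (q t *\<^sub>R Y t)) has_vector_derivative
        - (q t *\<^sub>R (- (p t *\<^sub>R X t) + q t *\<^sub>R D t) + ?q' t *\<^sub>R Y t)) (at t within I)"
      by (intro has_vector_derivative_minus scaleR_derivative dq[OF t] Y'[OF t])
    from dds_eq_of_derivative[OF I t D' this] show ?thesis
      by (simp add: D2_def algebra_simps)
  qed
  have "(D2 has_vector_derivative
      ((p s * q s) *\<^sub>R p s *\<^sub>R Y s + pq' *\<^sub>R X s) +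
      ((- ?q' s) *\<^sub>R (- (p s *\<^sub>R X s) + q s *\<^sub>R D s) + (- ?q'' s) *\<^sub>R Y s) +
      ((- (q s * q s)) *\<^sub>R (- (q s *\<^sub>R Y s)) + (- qq') *\<^sub>R D s)) (at s within I)"
    unfolding D2_def[abs_def]
    by (intro has_vector_derivative_add has_vector_derivative_minus scaleR_derivative
        dpq dqq dq'[OF s] X'[OF s] Y'[OF s] D'[OF s])
  note dds_eqI[OF I s this]
  moreover have "dds I (dds I (dds I D)) s = dds I D2 s"
    by (intro dds_cong dds_D s)
  ultimately have D3: "dds I (dds I (dds I D)) s =
      (pq' + p s * ?q' s) *\<^sub>R X s
      + (- ?q'' s + p s * p s * q s + q s * q s * q s) *\<^sub>R Y s
      - (q s * ?q' s + qq') *\<^sub>R D s"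
    by (simp add: algebra_simps)

  define A where "A = dds I (\<lambda>t. p t * q t) s / (p s * q s) + ?q' s / q s"
  define B where "B = p s * q s * dds I (\<lambda>t. 1 / p t * dds I (\<lambda>u. 1 / q u) t) s + (p s)\<^sup>2 + (q s)\<^sup>2"
  define C where "C = p s * q s * dds I (\<lambda>t. q t / p t) s"
  have nz_s: "p s \<noteq> 0" "q s \<noteq> 0"
    using nz s by auto
  have A: "A = ?p' s / p s + 2 * ?q' s / q s"
    using nz_s unfolding A_def dds_eqI[OF I s dpq] pq'_def by (simp add: field_simps)
  have X_coeff: "pq' + p s * ?q' s - A * (p s * q s) = 0"
    using nz_s unfolding A pq'_def by (simp add: field_simps)
  have Y_coeff: "- ?q'' s + p s * p s * q s + q s * q s * q s + A * ?q' s - B * q s = 0"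
    using nz_s unfolding A B_def inv_p_inv_q by (simp add: field_simps power2_eq_square)
  have D_coeff: "- (q s * ?q' s + qq') + A * (q s * q s) + C = 0"
    using nz_s unfolding A C_def q_over_p qq'_def by (simp add: field_simps)
  have "dds I (dds I (dds I D)) s - A *\<^sub>R dds I (dds I D) s + B *\<^sub>R dds I D s + C *\<^sub>R D s =
      (pq' + p s * ?q' s - A * (p s * q s)) *\<^sub>R X s
      + (- ?q'' s + p s * p s * q s + q s * q s * q s + A * ?q' s - B * q s) *\<^sub>R Y s
      + (- (q s * ?q' s + qq') + A * (q s * q s) + C) *\<^sub>R D s"
    unfolding D3 dds_D[OF s] D1 D2_def by (simp add: algebra_simps)
  also have "\<dots> = 0"
    unfolding X_coeff Y_coeff D_coeff by simp
  finally show ?thesis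
    unfolding A_def B_def C_def .
qed

theorem theorem17:
  fixes I :: "real set"
    and r \<xi> D :: "real \<Rightarrow> real^3"
    and \<pi> :: "real \<Rightarrow> (real^3) set"
    and p q :: "real \<Rightarrow> real"
  assumes "myller_configuration I r \<xi> \<pi>"
    and "\<forall>s\<in>I. K1 I \<xi> s > 0"
    and "D = alt_D I \<xi>"
    and "p = alt_p I \<xi>"
    and "q = alt_q I \<xi>"
    and "\<forall>s\<in>I. p s \<noteq> 0 \<and> q s \<noteq> 0"
  shows "\<forall>s\<in>I.
    dds I (dds I (dds I D)) s
    - (dds I (\<lambda>t. p t * q t) s / (p s * q s) + dds I q s / q s) *\<^sub>R dds I (dds I D) s
    + (p s * q s * dds I (\<lambda>t. 1 / p t * dds I (\<lambda>u. 1 / q u) t) s + (p s)\<^sup>2 + (q s)\<^sup>2) *\<^sub>R dds I D s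
    + (p s * q s * dds I (\<lambda>t. q t / p t) s) *\<^sub>R D s = 0"
proof
  fix s assume s: "s \<in> I"
  have I: "param_interval I" and \<xi>: "unit_field I \<xi>"
    using assms(1) by (auto simp: myller_configuration_def)
  note frame = I \<xi> assms(2)
  show "dds I (dds I (dds I D)) s
    - (dds I (\<lambda>t. p t * q t) s / (p s * q s) + dds I q s / q s) *\<^sub>R dds I (dds I D) s
    + (p s * q s * dds I (\<lambda>t. 1 / p t * dds I (\<lambda>u. 1 / q u) t) s + (p s)\<^sup>2 + (q s)\<^sup>2) *\<^sub>R dds I D s
    + (p s * q s * dds I (\<lambda>t. q t / p t) s) *\<^sub>R D s = 0"
  proof (rule third_frame_vector_ode[where X = "xi2 I \<xi>" and Y = "alt_Y I \<xi>",
        OF I _ _ assms(6) _ _ _ s])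
    show "smooth_on I p" "smooth_on I q"
      unfolding assms(4,5) by (rule smooth_alt_p[OF frame] smooth_alt_q[OF frame])+
    fix t assume t: "t \<in> I"
    show "(xi2 I \<xi> has_vector_derivative p t *\<^sub>R alt_Y I \<xi> t) (at t within I)"
      unfolding assms(4) by (rule xi2_derivative[OF frame t])
    show "(alt_Y I \<xi> has_vector_derivative - (p t *\<^sub>R xi2 I \<xi> t) + q t *\<^sub>R D t) (at t within I)"
      unfolding assms(3-5) by (rule alt_Y_derivative[OF frame t])
    show "(D has_vector_derivative - (q t *\<^sub>R alt_Y I \<xi> t)) (at t within I)"
      unfolding assms(3,5) by (rule alt_D_derivative[OF frame t])
  qed
qed

end
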